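(* Let $X$ be a topological space and let $f,g:X\to\mathbb{R}$ be arbitrary real-valued functions. Then $$\Lambda_\infty(M(f),M(g))\le\|f-g\|_\infty,$$ where $\|f-g\|_\infty=\sup_{x\in X}|f(x)-g(x)|$.
   Context: A persistence module $M$ consists of a vector space $M_a$ (over a fixed field) for each $a\in\mathbb{R}$ and linear maps $M(a\le b):M_a\to M_b$ for $a\le b$, with $M(a\le a)=\mathrm{id}$ and $M(b\le c)\circ M(a\le b)=M(a\le c)$ for $a\le b\le c$. Put $\beta^{a,b}=\dim\operatorname{im}M(a\le b)$. The persistence landscape of $M$ is $\lambda:\mathbb{N}\times\mathbb{R}\to[-\infty,\infty]$, $\mathbb{N}=\{1,2,\dots\}$, $\lambda(k,t)=\lambda_k(t)=\sup\{m\ge0 : \beta^{t-m,t+m}\ge k\}$, with $\sup\emptyset=0$. For $f:X\to\mathbb{R}$, $M(f)$ is the persistence module with $M(f)_a=H(f^{-1}((-\infty,a]))$ and $M(f)(a\le b)$ induced by inclusion, where $H$ is singular homology in a fixed degree with coefficients in a fixed field. For persistence modules $M,M'$ with landscapes $\lambda,\lambda'$, $\Lambda_\infty(M,M')=\|\lambda-\lambda'\|_\infty$, the $L^\infty$ norm on $\mathbb{N}\times\mathbb{R}$ (counting measure times Lebesgue measure), possibly infinite, with the convention $\infty-\infty=0$. *)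

theory Defs
  imports
    "HOL-Homology.Homology"
    "HOL-Probability.Essential_Supremum"
    "Jordan_Normal_Form.VS_Connect"
    "HOL-Library.Extended_Nat"
begin

hide_const (open) Multiset.mult Polynomial.smult Modules.module

section \<open>Persistence modules\<close>

record ('k, 'v) pers_module =
  pspace :: "real \<Rightarrow> ('k, 'v) module"
  pmap :: "real \<Rightarrow> real \<Rightarrow> 'v \<Rightarrow> 'v"

locale persistence_module =
  fixes K :: "('k, 'r) ring_scheme" and P :: "('k, 'v) pers_module"
  assumes vectorspace_pspace: "vectorspace K (pspace P a)"
    and linear_pmap: "a \<le> b \<Longrightarrow> linear_map K (pspace P a) (pspace P b) (pmap P a b)"
    and pmap_refl: "x \<in> carrier (pspace P a) \<Longrightarrow> pmap P a a x = x"
    and pmap_trans: "\<lbrakk>a \<le> b; b \<le> c; x \<in> carrier (pspace P a)\<rbrakk>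
      \<Longrightarrow> pmap P b c (pmap P a b x) = pmap P a c x"

text \<open>\<^const>\<open>vectorspace.dim\<close> is only meaningful for finite-dimensional spaces; all infinite
  dimensions are identified with \<open>\<infinity>\<close>.\<close>

definition vdim :: "('k, 'r) ring_scheme \<Rightarrow> ('k, 'v, 'm) module_scheme \<Rightarrow> enat" where
  "vdim K V = (if vectorspace.fin_dim K V then enat (vectorspace.dim K V) else \<infinity>)"

definition pers_betti ::
    "('k, 'r) ring_scheme \<Rightarrow> ('k, 'v) pers_module \<Rightarrow> real \<Rightarrow> real \<Rightarrow> enat" where
  "pers_betti K P a b = vdim K ((pspace P b)\<lparr>carrier := pmap P a b ` carrier (pspace P a)\<rparr>)"

section \<open>Persistence landscapes\<close>

text \<open>The supremum of the empty set is \<open>-\<infinity>\<close> in \<^typ>\<open>ereal\<close>, so the convention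
  \<open>sup \<emptyset> = 0\<close> has to be imposed.\<close>

definition landscape ::
    "('k, 'r) ring_scheme \<Rightarrow> ('k, 'v) pers_module \<Rightarrow> nat \<Rightarrow> real \<Rightarrow> ereal" where
  "landscape K P k t =
    (let S = {m::real. 0 \<le> m \<and> enat k \<le> pers_betti K P (t - m) (t + m)}
     in if S = {} then 0 else (SUP m\<in>S. ereal m))"

text \<open>\<^typ>\<open>ereal\<close> has \<open>\<infinity> - \<infinity> = \<infinity>\<close>, whereas landscapes use \<open>\<infinity> - \<infinity> = 0\<close>.\<close>

definition ext_abs_diff :: "ereal \<Rightarrow> ereal \<Rightarrow> ennreal" where
  "ext_abs_diff u v = (if u = v then 0 else e2ennreal \<bar>u - v\<bar>)"

definition landscape_dist_infty ::
    "('k, 'r) ring_scheme \<Rightarrow> ('k, 'v) pers_module \<Rightarrow> ('k, 'w) pers_module \<Rightarrow> ennreal" where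
  "landscape_dist_infty K P Q =
    esssup (count_space {1..} \<Otimes>\<^sub>M lebesgue)
      (\<lambda>(k, t). ext_abs_diff (landscape K P k t) (landscape K Q k t))"

section \<open>Singular homology with coefficients in a field\<close>

text \<open>HOL-Homology only provides integer coefficients. The following repeats its
  absolute chain complex with coefficients in a field \<open>'k\<close>, on the same singular simplices and
  faces.\<close>

type_synonym ('k, 'a) field_chain = "((nat \<Rightarrow> real) \<Rightarrow> 'a) \<Rightarrow>\<^sub>0 'k"

definition field_chain_set :: "nat \<Rightarrow> 'a topology \<Rightarrow> ('k::field, 'a) field_chain set" where
  "field_chain_set p X = {c. Poly_Mapping.keys c \<subseteq> singular_simplex_set p X}"

definition field_boundary :: "nat \<Rightarrow> ('k::field, 'a) field_chain \<Rightarrow> ('k, 'a) field_chain" where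
  "field_boundary p c =
    (if p = 0 then 0 else
     \<Sum>\<sigma>\<in>Poly_Mapping.keys c. \<Sum>i\<le>p.
       Poly_Mapping.single (singular_face p i \<sigma>) ((- 1) ^ i * Poly_Mapping.lookup c \<sigma>))"

definition field_chain_map ::
    "nat \<Rightarrow> ('a \<Rightarrow> 'b) \<Rightarrow> ('k::field, 'a) field_chain \<Rightarrow> ('k, 'b) field_chain" where
  "field_chain_map p h c =
    (\<Sum>\<sigma>\<in>Poly_Mapping.keys c.
       Poly_Mapping.single (simplex_map p h \<sigma>) (Poly_Mapping.lookup c \<sigma>))"

definition field_cycles :: "nat \<Rightarrow> 'a topology \<Rightarrow> ('k::field, 'a) field_chain set" where
  "field_cycles p X = {c \<in> field_chain_set p X. field_boundary p c = 0}"

definition field_boundaries :: "nat \<Rightarrow> 'a topology \<Rightarrow> ('k::field, 'a) field_chain set" where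
  "field_boundaries p X = field_boundary (Suc p) ` field_chain_set (Suc p) X"

text \<open>Since modules are records extending rings, the components \<open>mult\<close> and \<open>one\<close> have to
  be filled in, but they play no role.\<close>

definition cycle_space :: "nat \<Rightarrow> 'a topology \<Rightarrow> ('k::field, ('k, 'a) field_chain) module" where
  "cycle_space p X =
    \<lparr>carrier = field_cycles p X, mult = (\<lambda>_ _. 0), one = 0, zero = 0, add = (+),
     smult = (\<lambda>r. Poly_Mapping.map ((*) r))\<rparr>"

definition quotient_space :: "('k, 'v, 'm) module_scheme \<Rightarrow> 'v set \<Rightarrow> ('k, 'v set) module" where
  "quotient_space V W =
    \<lparr>carrier = a_rcosets\<^bsub>V\<^esub> W, mult = (\<lambda>_ _. W), one = W, zero = W, add = set_add V,
     smult = (\<lambda>r A. \<Union>x\<in>A. W +>\<^bsub>V\<^esub> (r \<odot>\<^bsub>V\<^esub> x))\<rparr>"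

definition field_homology ::
    "nat \<Rightarrow> 'a topology \<Rightarrow> ('k::field, ('k, 'a) field_chain set) module" where
  "field_homology p X = quotient_space (cycle_space p X) (field_boundaries p X)"

text \<open>A class is a set of cycles; all representatives of a class yield the same coset in the
  union.\<close>

definition field_hom_induced ::
    "nat \<Rightarrow> 'b topology \<Rightarrow> ('a \<Rightarrow> 'b) \<Rightarrow>
     ('k::field, 'a) field_chain set \<Rightarrow> ('k, 'b) field_chain set" where
  "field_hom_induced p Y h A =
    (\<Union>c\<in>A. field_boundaries p Y +>\<^bsub>cycle_space p Y\<^esub> field_chain_map p h c)"

section \<open>Sublevel set persistence\<close>

definition sublevel :: "'a topology \<Rightarrow> ('a \<Rightarrow> real) \<Rightarrow> real \<Rightarrow> 'a topology" where
  "sublevel X f a = subtopology X {x \<in> topspace X. f x \<le> a}"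

definition sublevel_module ::
    "nat \<Rightarrow> 'a topology \<Rightarrow> ('a \<Rightarrow> real) \<Rightarrow> ('k::field, ('k, 'a) field_chain set) pers_module" where
  "sublevel_module p X f =
    \<lparr>pspace = (\<lambda>a. field_homology p (sublevel X f a)),
     pmap = (\<lambda>a b. field_hom_induced p (sublevel X f b) id)\<rparr>"

definition sup_dist :: "'a topology \<Rightarrow> ('a \<Rightarrow> real) \<Rightarrow> ('a \<Rightarrow> real) \<Rightarrow> ennreal" where
  "sup_dist X f g = (SUP x\<in>topspace X. ennreal \<bar>f x - g x\<bar>)"

section \<open>Sublevel set homology is a persistence module\<close>

abbreviation scal :: "'k::field \<Rightarrow> ('s \<Rightarrow>\<^sub>0 'k) \<Rightarrow> ('s \<Rightarrow>\<^sub>0 'k)" where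
  "scal r \<equiv> Poly_Mapping.map ((*) r)"

lemma lookup_scal: "Poly_Mapping.lookup (scal r c) s = (r::'k::field) * Poly_Mapping.lookup c s"
  by (simp add: Poly_Mapping.map.rep_eq when_def)

lemma keys_scal: "Poly_Mapping.keys (scal r c) \<subseteq> Poly_Mapping.keys c"
  by (auto simp: in_keys_iff lookup_scal)

lemma keys_sum_mono:
  assumes "finite A" "Poly_Mapping.keys c \<subseteq> A" "\<And>s. F s 0 = (0::'m::comm_monoid_add)"
  shows "(\<Sum>s\<in>Poly_Mapping.keys c. F s (Poly_Mapping.lookup c s)) = (\<Sum>s\<in>A. F s (Poly_Mapping.lookup c s))"
  using assms by (intro sum.mono_neutral_left) (auto simp: in_keys_iff)

lemma keys_sum_add:
  fixes c d :: "'s \<Rightarrow>\<^sub>0 'k::ab_group_add"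
  assumes "\<And>s x y. F s (x + y) = F s x + (F s y::'m::ab_group_add)"
  shows "(\<Sum>s\<in>Poly_Mapping.keys (c + d). F s (Poly_Mapping.lookup (c + d) s)) =
    (\<Sum>s\<in>Poly_Mapping.keys c. F s (Poly_Mapping.lookup c s)) +
    (\<Sum>s\<in>Poly_Mapping.keys d. F s (Poly_Mapping.lookup d s))"
proof -
  have 0: "F s 0 = 0" for s using assms[of s 0 0] by simp
  let ?A = "Poly_Mapping.keys c \<union> Poly_Mapping.keys d"
  show ?thesis
    using keys_sum_mono[of ?A "c + d" F] keys_sum_mono[of ?A c F] keys_sum_mono[of ?A d F] 0
    by (simp add: Poly_Mapping.keys_add lookup_add assms sum.distrib)
qed

lemma keys_sum_scal:
  fixes c :: "'s \<Rightarrow>\<^sub>0 'k::field"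
  assumes "\<And>s x. F s (r * x) = scal r (F s x)" "\<And>s. F s 0 = (0 :: 't \<Rightarrow>\<^sub>0 'k)"
  shows "(\<Sum>s\<in>Poly_Mapping.keys (scal r c). F s (Poly_Mapping.lookup (scal r c) s)) =
    scal r (\<Sum>s\<in>Poly_Mapping.keys c. F s (Poly_Mapping.lookup c s))"
  using keys_sum_mono[of "Poly_Mapping.keys c" "scal r c" F] assms keys_scal[of r c]
  by (auto intro!: poly_mapping_eqI simp: lookup_scal lookup_sum sum_distrib_left)

lemma single_scal: "Poly_Mapping.single s (r * x) = scal r (Poly_Mapping.single s (x::'k::field))"
  by (rule poly_mapping_eqI) (simp add: lookup_scal lookup_single when_def)

lemma scal_sum: "scal r (sum F A) = (\<Sum>i\<in>A. scal r (F i))"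
  by (rule poly_mapping_eqI) (simp add: lookup_scal lookup_sum sum_distrib_left)

lemma scal_0[simp]: "scal r 0 = 0"
  by (rule poly_mapping_eqI) (simp add: lookup_scal)

lemma field_boundary_add: "field_boundary p (c + d) = field_boundary p c + field_boundary p d"
  unfolding field_boundary_def
  using keys_sum_add[where F = "\<lambda>\<sigma> x. \<Sum>i\<le>p. Poly_Mapping.single (singular_face p i \<sigma>) ((- 1) ^ i * x)" and c = c and d = d]
  by (simp add: distrib_left single_add sum.distrib)

lemma field_boundary_scal: "field_boundary p (scal r c) = scal r (field_boundary p c)"
proof (cases "p = 0")
  case True
  then show ?thesis by (simp add: field_boundary_def)
next
  case False
  have "(\<Sum>i\<le>p. Poly_Mapping.single (singular_face p i \<sigma>) ((- 1) ^ i * (r * x))) =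
    scal r (\<Sum>i\<le>p. Poly_Mapping.single (singular_face p i \<sigma>) ((- 1) ^ i * x))" for \<sigma> x
    unfolding scal_sum single_scal[symmetric] by (simp only: mult.left_commute)
  then show ?thesis
    unfolding field_boundary_def if_not_P[OF False]
    by (intro keys_sum_scal[where F = "\<lambda>\<sigma> x. \<Sum>i\<le>p. Poly_Mapping.single (singular_face p i \<sigma>) ((- 1) ^ i * x)"]) simp_all
qed

lemma field_boundary_0[simp]: "field_boundary p 0 = 0"
  by (simp add: field_boundary_def)

lemma field_chain_map_add: "field_chain_map p h (c + d) = field_chain_map p h c + field_chain_map p h d"
  unfolding field_chain_map_def
  by (rule keys_sum_add) (simp add: single_add)

lemma field_chain_map_scal: "field_chain_map p h (scal r c) = scal r (field_chain_map p h c)"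
  unfolding field_chain_map_def
  by (rule keys_sum_scal) (rule single_scal, simp)

lemma poly_sum_single: "(\<Sum>s\<in>Poly_Mapping.keys c. Poly_Mapping.single s (Poly_Mapping.lookup c s)) = c"
  by (rule poly_mapping_eqI) (simp add: lookup_sum lookup_single when_def in_keys_iff)

lemma field_chain_map_id:
  assumes "c \<in> field_chain_set p X" shows "field_chain_map p id c = c"
proof -
  have "simplex_map p id s = s" if "s \<in> Poly_Mapping.keys c" for s
    using assms that unfolding field_chain_set_def simplex_map_def singular_simplex_def
    by (auto simp: extensional_restrict)
  then show ?thesis unfolding field_chain_map_def by (simp add: poly_sum_single)
qed

lemma field_chain_set_add: "\<lbrakk>c \<in> field_chain_set p X; d \<in> field_chain_set p X\<rbrakk> \<Longrightarrow> c + d \<in> field_chain_set p X"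
  using Poly_Mapping.keys_add[of c d] by (auto simp: field_chain_set_def)
lemma field_chain_set_scal: "c \<in> field_chain_set p X \<Longrightarrow> scal r c \<in> field_chain_set p X"
  using keys_scal[of r c] by (auto simp: field_chain_set_def)
lemma field_chain_set_0[simp]: "0 \<in> field_chain_set p X"
  by (auto simp: field_chain_set_def)
lemma field_chain_set_sum: "(\<And>i. i \<in> A \<Longrightarrow> F i \<in> field_chain_set p X) \<Longrightarrow> sum F A \<in> field_chain_set p X"
  by (induction A rule: infinite_finite_induct) (auto simp: field_chain_set_add)

lemma field_boundary_chain:
  assumes "c \<in> field_chain_set (Suc p) X" shows "field_boundary (Suc p) c \<in> field_chain_set p X"
proof -
  have "singular_simplex p X (singular_face (Suc p) i s)" if "i \<le> Suc p" "s \<in> Poly_Mapping.keys c" for i s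
    using assms that singular_simplex_singular_face[of "Suc p" X s i] by (auto simp: field_chain_set_def)
  then have "Poly_Mapping.single (singular_face (Suc p) i s) x \<in> field_chain_set p X"
    if "i \<le> Suc p" "s \<in> Poly_Mapping.keys c" for i s and x :: 'b
    using that by (auto simp: field_chain_set_def)
  then show ?thesis unfolding field_boundary_def
    by (auto intro!: field_chain_set_sum simp del: sum.atMost_Suc)
qed

text \<open>A field element times an integer chain; used to inherit \<open>\<partial>\<partial> = 0\<close> from HOL-Homology.\<close>

definition of_int_chain :: "'k::field \<Rightarrow> ('s \<Rightarrow>\<^sub>0 int) \<Rightarrow> ('s \<Rightarrow>\<^sub>0 'k)" where
  "of_int_chain r c = (\<Sum>s\<in>Poly_Mapping.keys c. Poly_Mapping.single s (r * of_int (Poly_Mapping.lookup c s)))"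

lemma of_int_chain_add: "of_int_chain r (c + d) = of_int_chain r c + of_int_chain r d"
  unfolding of_int_chain_def by (rule keys_sum_add) (simp add: single_add distrib_left)
lemma of_int_chain_0[simp]: "of_int_chain r 0 = 0" by (simp add: of_int_chain_def)
lemma of_int_chain_sum: "of_int_chain r (sum F A) = (\<Sum>i\<in>A. of_int_chain r (F i))"
  by (induction A rule: infinite_finite_induct) (auto simp: of_int_chain_add)
lemma lookup_of_int_chain: "Poly_Mapping.lookup (of_int_chain r c) s = r * of_int (Poly_Mapping.lookup c s)"
  by (auto simp: of_int_chain_def lookup_sum lookup_single when_def in_keys_iff)
lemma of_int_chain_frag: "of_int_chain r (frag_cmul k (frag_of s)) = Poly_Mapping.single s (r * of_int k)"
  by (rule poly_mapping_eqI) (auto simp: lookup_of_int_chain lookup_single when_def)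

lemma field_boundary_sum: "field_boundary p (sum F A) = (\<Sum>i\<in>A. field_boundary p (F i))"
  by (induction A rule: infinite_finite_induct) (auto simp: field_boundary_add)

lemma field_boundary_single:
  "field_boundary (Suc p) (Poly_Mapping.single s r) = of_int_chain r (chain_boundary (Suc p) (frag_of s))"
  by (cases "r = 0") (auto simp: field_boundary_def chain_boundary_def of_int_chain_sum of_int_chain_frag frag_extend_def mult.commute
    simp del: sum.atMost_Suc)

lemma of_int_chain_boundary: "field_boundary p (of_int_chain r c) = of_int_chain r (chain_boundary p c)"
proof (cases p)
  case 0 then show ?thesis by (simp add: field_boundary_def chain_boundary_def)
next
  case (Suc q)
  have "Poly_Mapping.keys c \<subseteq> UNIV" by simp
  then show ?thesis unfolding Suc
  proof (induction c rule: frag_induction)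
    case zero then show ?case by (simp add: chain_boundary_def)
  next
    case (one x)
    have "of_int_chain r (frag_of x) = Poly_Mapping.single x r" using of_int_chain_frag[of r 1 x] by simp
    then show ?case by (simp add: field_boundary_single)
  next
    case (diff a b)
    have m: "of_int_chain r (u - v) + of_int_chain r v = of_int_chain r u" for u v :: "'z chain" by (metis diff_add_cancel of_int_chain_add)
    have m': "field_boundary (Suc q) (of_int_chain r (a - b)) + field_boundary (Suc q) (of_int_chain r b) = field_boundary (Suc q) (of_int_chain r a)"
      by (metis field_boundary_add m)
    have "of_int_chain r (chain_boundary (Suc q) a - chain_boundary (Suc q) b) + of_int_chain r (chain_boundary (Suc q) b) = of_int_chain r (chain_boundary (Suc q) a)"
      by (rule m)
    then show ?case using m' diff by (metis add_right_cancel chain_boundary_diff)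
  qed
qed

lemma field_boundary_boundary:
  fixes c :: "('k::field, 'a) field_chain"
  assumes "c \<in> field_chain_set (Suc p) X"
  shows "field_boundary p (field_boundary (Suc p) c) = 0"
proof -
  have "field_boundary p (field_boundary (Suc p) (Poly_Mapping.single s r)) = 0" if "s \<in> Poly_Mapping.keys c" for s and r :: 'k
  proof -
    have "singular_chain (Suc p) X (frag_of s)"
      using that assms by (auto simp: field_chain_set_def singular_chain_def)
    then have "chain_boundary p (chain_boundary (Suc p) (frag_of s)) = 0"
      using chain_boundary_boundary_alt by blast
    then show ?thesis by (simp add: field_boundary_single of_int_chain_boundary)
  qed
  then have "field_boundary p (field_boundary (Suc p) (\<Sum>s\<in>Poly_Mapping.keys c. Poly_Mapping.single s (Poly_Mapping.lookup c s))) = 0"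
    by (simp add: field_boundary_sum)
  then show ?thesis by (simp add: poly_sum_single)
qed

lemma scal_minus1: "scal (- 1) v = - v"
  by (rule poly_mapping_eqI) (simp add: lookup_scal)

lemma field_boundaries_add: "\<lbrakk>u \<in> field_boundaries p X; v \<in> field_boundaries p X\<rbrakk> \<Longrightarrow> u + v \<in> field_boundaries p X"
  unfolding field_boundaries_def
  by (elim imageE) (simp add: field_chain_set_add imageI flip: field_boundary_add)
lemma field_boundaries_scal: "u \<in> field_boundaries p X \<Longrightarrow> scal r u \<in> field_boundaries p X"
  unfolding field_boundaries_def
  by (elim imageE) (simp add: field_chain_set_scal imageI flip: field_boundary_scal)
lemma field_boundaries_0[simp]: "0 \<in> field_boundaries p X"
  unfolding field_boundaries_def by (metis field_boundary_0 field_chain_set_0 image_eqI)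
lemma field_boundaries_minus: "u \<in> field_boundaries p X \<Longrightarrow> - u \<in> field_boundaries p X"
  using field_boundaries_scal[of u p X "-1"] by (simp add: scal_minus1)
lemma field_boundaries_diff: "\<lbrakk>u \<in> field_boundaries p X; v \<in> field_boundaries p X\<rbrakk> \<Longrightarrow> u - v \<in> field_boundaries p X"
  using field_boundaries_add[of u p X "-v"] field_boundaries_minus[of v] by simp

lemma scal_add: "scal r (u + v) = scal r u + scal r v"
  by (rule poly_mapping_eqI) (simp add: lookup_scal lookup_add algebra_simps)
lemma scal_diff: "scal r (u - v) = scal r u - scal r v"
  by (rule poly_mapping_eqI) (simp add: lookup_scal lookup_minus algebra_simps)

definition homology_class :: "nat \<Rightarrow> 'a topology \<Rightarrow> ('k::field, 'a) field_chain \<Rightarrow> ('k, 'a) field_chain set" where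
  "homology_class p X x = {y. y - x \<in> field_boundaries p X}"

lemma coset_homology_class: "field_boundaries p X +>\<^bsub>cycle_space p X\<^esub> x = homology_class p X x"
proof -
  have "\<exists>h\<in>field_boundaries p X. y = h + x" if "y - x \<in> field_boundaries p X" for y
    using that by (intro bexI[of _ "y - x"]) simp_all
  then show ?thesis by (auto simp: a_r_coset_def' cycle_space_def homology_class_def)
qed

lemma homology_class_eq_iff: "homology_class p X x = homology_class p X y \<longleftrightarrow> x - y \<in> field_boundaries p X"
proof
  assume "homology_class p X x = homology_class p X y"
  moreover have "x \<in> homology_class p X x" by (simp add: homology_class_def)
  ultimately have "x \<in> homology_class p X y" by simp
  then show "x - y \<in> field_boundaries p X" by (simp add: homology_class_def)
next
  assume a: "x - y \<in> field_boundaries p X"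
  have "z - y \<in> field_boundaries p X" if "z - x \<in> field_boundaries p X" for z
    using field_boundaries_add[OF that a] by simp
  moreover have "z - x \<in> field_boundaries p X" if "z - y \<in> field_boundaries p X" for z
    using field_boundaries_diff[OF that a] by simp
  ultimately show "homology_class p X x = homology_class p X y" unfolding homology_class_def by blast
qed

lemma UN_homology_class:
  assumes "\<And>y. y - x \<in> field_boundaries p X \<Longrightarrow> F y = F x"
  shows "(\<Union>y\<in>homology_class p X x. F y) = F x"
proof -
  have "x \<in> homology_class p X x" by (simp add: homology_class_def)
  moreover have "F y = F x" if "y \<in> homology_class p X x" for y
    using that assms unfolding homology_class_def by blast
  ultimately show ?thesis by blast
qed

lemma carrier_homology: "carrier (field_homology p X) = homology_class p X ` field_cycles p X"
  unfolding field_homology_def quotient_space_def partial_object.simps A_RCOSETS_def' coset_homology_class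
  unfolding cycle_space_def partial_object.simps by blast

lemma zero_homology: "zero (field_homology p X) = homology_class p X 0"
  by (simp add: field_homology_def quotient_space_def homology_class_def)

lemma add_homology: "add (field_homology p X) (homology_class p X x) (homology_class p X y) = homology_class p X (x + y)"
proof -
  have "\<exists>a. a - x \<in> field_boundaries p X \<and> (\<exists>b. b - y \<in> field_boundaries p X \<and> z = a + b)"
    if "z - (x + y) \<in> field_boundaries p X" for z
    by (rule exI[of _ "z - y"]) (use that in \<open>auto intro!: exI[of _ y] simp: algebra_simps\<close>)
  moreover have "a + b - (x + y) \<in> field_boundaries p X"
    if "a - x \<in> field_boundaries p X" "b - y \<in> field_boundaries p X" for a b
    using field_boundaries_add[OF that] by (simp add: algebra_simps)
  ultimately have "(\<Union>a\<in>homology_class p X x. \<Union>b\<in>homology_class p X y. {a + b}) = homology_class p X (x + y)"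
    unfolding homology_class_def by blast
  moreover have "add (field_homology p X) (homology_class p X x) (homology_class p X y) = (\<Union>a\<in>homology_class p X x. \<Union>b\<in>homology_class p X y. {a + b})"
    unfolding field_homology_def quotient_space_def ring.simps set_add_def' cycle_space_def by (rule refl)
  ultimately show ?thesis by (rule trans[rotated])
qed

lemma smult_homology: "module.smult (field_homology p X) r (homology_class p X x) = homology_class p X (scal r x)"
proof -
  have "homology_class p X (scal r y) = homology_class p X (scal r x)" if "y - x \<in> field_boundaries p X" for y
    using field_boundaries_scal[OF that, of r] by (simp add: homology_class_eq_iff scal_diff)
  then have "(\<Union>y\<in>homology_class p X x. homology_class p X (scal r y)) = homology_class p X (scal r x)" by (rule UN_homology_class)
  moreover have "module.smult (field_homology p X) r (homology_class p X x) = (\<Union>y\<in>homology_class p X x. homology_class p X (scal r y))"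
    unfolding field_homology_def quotient_space_def module.simps coset_homology_class unfolding cycle_space_def by simp
  ultimately show ?thesis by (rule trans[rotated])
qed

lemma field_cycles_0: "0 \<in> field_cycles p X" 
  unfolding field_cycles_def by simp
lemma field_cycles_add: "\<lbrakk>u \<in> field_cycles p X; v \<in> field_cycles p X\<rbrakk> \<Longrightarrow> u + v \<in> field_cycles p X"
  unfolding field_cycles_def by (simp add: field_boundary_add field_chain_set_add)
lemma field_cycles_scal: "u \<in> field_cycles p X \<Longrightarrow> scal r u \<in> field_cycles p X"
  unfolding field_cycles_def by (simp add: field_boundary_scal field_chain_set_scal)

lemma vectorspace_field_homology:
  "vectorspace class_ring (field_homology p X :: ('k::field, ('k, 'a) field_chain set) module)"
proof -
  let ?H = "field_homology p X :: ('k::field, ('k, 'a) field_chain set) module"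
  have "module class_ring ?H"
  proof (rule module_criteria)
    show "cring (class_ring::'k ring)" by (rule class_cring.cring_axioms)
    have "homology_class p X v \<oplus>\<^bsub>?H\<^esub> homology_class p X (scal (-1) v) = \<zero>\<^bsub>?H\<^esub>" for v
      by (simp add: add_homology zero_homology scal_minus1)
    then show "\<forall>v\<in>carrier ?H. \<exists>neg_v\<in>carrier ?H. v \<oplus>\<^bsub>?H\<^esub> neg_v = \<zero>\<^bsub>?H\<^esub>"
      unfolding carrier_homology using field_cycles_scal by blast
    have "scal (a * b) v = scal a (scal b v)" "scal 1 v = v" "scal (a + b) v = scal a v + scal b v"
      for a b :: 'k and v :: "('k, 'a) field_chain"
      by (rule poly_mapping_eqI, simp add: lookup_scal lookup_add algebra_simps)+
    note s = this
    show "\<forall>a b v. a \<in> carrier (class_ring::'k ring) \<and> b \<in> carrier class_ring \<and> v \<in> carrier ?H \<longrightarrow>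
      (a \<otimes>\<^bsub>class_ring\<^esub> b) \<odot>\<^bsub>?H\<^esub> v = a \<odot>\<^bsub>?H\<^esub> (b \<odot>\<^bsub>?H\<^esub> v)"
      by (simp add: carrier_homology image_iff) (metis s(1) smult_homology)
    show "\<forall>v\<in>carrier ?H. \<one>\<^bsub>class_ring\<^esub> \<odot>\<^bsub>?H\<^esub> v = v"
      by (simp add: carrier_homology smult_homology s(2))
    show "\<forall>a b v. a \<in> carrier (class_ring::'k ring) \<and> b \<in> carrier class_ring \<and> v \<in> carrier ?H \<longrightarrow>
      (a \<oplus>\<^bsub>class_ring\<^esub> b) \<odot>\<^bsub>?H\<^esub> v = (a \<odot>\<^bsub>?H\<^esub> v) \<oplus>\<^bsub>?H\<^esub> (b \<odot>\<^bsub>?H\<^esub> v)"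
      by (simp add: carrier_homology image_iff) (metis s(3) smult_homology add_homology)
    show "\<forall>a v w. a \<in> carrier (class_ring::'k ring) \<and> v \<in> carrier ?H \<and> w \<in> carrier ?H \<longrightarrow>
      a \<odot>\<^bsub>?H\<^esub> (v \<oplus>\<^bsub>?H\<^esub> w) = (a \<odot>\<^bsub>?H\<^esub> v) \<oplus>\<^bsub>?H\<^esub> (a \<odot>\<^bsub>?H\<^esub> w)"
      by (simp add: carrier_homology image_iff) (metis scal_add smult_homology add_homology)
    show "\<forall>v w. v \<in> carrier ?H \<and> w \<in> carrier ?H \<longrightarrow> v \<oplus>\<^bsub>?H\<^esub> w = w \<oplus>\<^bsub>?H\<^esub> v"
      by (simp add: carrier_homology image_iff) (metis add_homology add.commute)
    show "\<forall>v w x. v \<in> carrier ?H \<and> w \<in> carrier ?H \<and> x \<in> carrier ?H \<longrightarrow>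
      v \<oplus>\<^bsub>?H\<^esub> w \<oplus>\<^bsub>?H\<^esub> x = v \<oplus>\<^bsub>?H\<^esub> (w \<oplus>\<^bsub>?H\<^esub> x)"
      by (simp add: carrier_homology image_iff) (metis add_homology add.assoc)
    show "\<zero>\<^bsub>?H\<^esub> \<in> carrier ?H"
      unfolding carrier_homology zero_homology using field_cycles_0 by blast
    show "\<forall>v w. v \<in> carrier ?H \<and> w \<in> carrier ?H \<longrightarrow> v \<oplus>\<^bsub>?H\<^esub> w \<in> carrier ?H"
      unfolding carrier_homology image_iff using field_cycles_add by (metis add_homology)
    show "\<forall>c v. c \<in> carrier (class_ring::'k ring) \<and> v \<in> carrier ?H \<longrightarrow> c \<odot>\<^bsub>?H\<^esub> v \<in> carrier ?H"
      unfolding carrier_homology image_iff using field_cycles_scal by (metis smult_homology)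
    show "\<forall>v\<in>carrier ?H. v \<oplus>\<^bsub>?H\<^esub> \<zero>\<^bsub>?H\<^esub> = v"
      by (simp add: carrier_homology zero_homology add_homology)
  qed
  then show ?thesis by (intro vectorspace.intro class_field.field_axioms)
qed

lemma field_hom_induced_homology_class:
  fixes x :: "('k::field, 'a) field_chain"
  assumes "\<And>c :: ('k, 'a) field_chain. c \<in> field_boundaries p X \<Longrightarrow> field_chain_map p h c \<in> field_boundaries p Y"
  shows "field_hom_induced p Y h (homology_class p X x) = homology_class p Y (field_chain_map p h x)"
proof -
  have "homology_class p Y (field_chain_map p h y) = homology_class p Y (field_chain_map p h x)" if "y - x \<in> field_boundaries p X" for y
    using assms[OF that] field_chain_map_add[of p h "y - x" x] by (simp add: homology_class_eq_iff)
  then show ?thesis unfolding field_hom_induced_def coset_homology_class by (rule UN_homology_class)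
qed

lemma sublevel_simplex: "a \<le> b \<Longrightarrow> singular_simplex p (sublevel X f a) s \<Longrightarrow> singular_simplex p (sublevel X f b) s"
  unfolding sublevel_def by (auto simp: singular_simplex_subtopology)

lemma sublevel_mono:
  assumes "a \<le> b"
  shows "field_chain_set p (sublevel X f a) \<subseteq> field_chain_set p (sublevel X f b)"
    "field_cycles p (sublevel X f a) \<subseteq> field_cycles p (sublevel X f b)"
    "field_boundaries p (sublevel X f a) \<subseteq> field_boundaries p (sublevel X f b)"
proof -
  show *: "field_chain_set q (sublevel X f a) \<subseteq> field_chain_set q (sublevel X f b)" for q
    by (auto simp: field_chain_set_def dest: sublevel_simplex[OF assms])
  show "field_cycles p (sublevel X f a) \<subseteq> field_cycles p (sublevel X f b)"
    "field_boundaries p (sublevel X f a) \<subseteq> field_boundaries p (sublevel X f b)"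
    using * by (auto simp: field_cycles_def field_boundaries_def)
qed

lemma field_boundaries_chain: "c \<in> field_boundaries p X \<Longrightarrow> c \<in> field_chain_set p X"
  by (auto simp: field_boundaries_def field_boundary_chain)

lemma pmap_homology_class:
  fixes x :: "('k::field, 'a) field_chain"
  assumes "a \<le> b" "x \<in> field_cycles p (sublevel X f a)"
  shows "field_hom_induced p (sublevel X f b) id (homology_class p (sublevel X f a) x) = homology_class p (sublevel X f b) x"
proof -
  have "field_chain_map p id x = x" using assms by (auto simp: field_cycles_def intro: field_chain_map_id)
  moreover have "field_chain_map p id c \<in> field_boundaries p (sublevel X f b)" if "c \<in> field_boundaries p (sublevel X f a)" for c :: "('k,'a) field_chain"
    using field_chain_map_id[OF field_boundaries_chain[OF that]] sublevel_mono(3)[OF assms(1)] that by auto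
  ultimately show ?thesis by (simp add: field_hom_induced_homology_class)
qed

lemma persistence_module_sublevel:
  "persistence_module class_ring (sublevel_module p X f :: ('k::field, ('k, 'a) field_chain set) pers_module)"
proof (rule persistence_module.intro)
  fix a b c :: real
  let ?P = "sublevel_module p X f :: ('k::field, ('k, 'a) field_chain set) pers_module"
  show v: "vectorspace class_ring (pspace ?P a)" for a
    by (simp add: sublevel_module_def vectorspace_field_homology)
  show "linear_map class_ring (pspace ?P a) (pspace ?P b) (pmap ?P a b)" if "a \<le> b"
  proof (intro linear_map.intro mod_hom.intro mod_hom_axioms.intro v)
    show "module class_ring (pspace ?P a)" "module class_ring (pspace ?P b)"
      using v vectorspace_def by blast+
    show "pmap ?P a b \<in> module_hom class_ring (pspace ?P a) (pspace ?P b)"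
      using that
      by (auto simp: module_hom_def sublevel_module_def carrier_homology add_homology smult_homology pmap_homology_class field_cycles_add field_cycles_scal
        intro!: imageI subsetD[OF sublevel_mono(2)[OF that]])
  qed
  show "pmap ?P a a x = x" if "x \<in> carrier (pspace ?P a)" for x
    using that by (auto simp: sublevel_module_def carrier_homology pmap_homology_class)
  show "pmap ?P b c (pmap ?P a b x) = pmap ?P a c x" if "a \<le> b" "b \<le> c" "x \<in> carrier (pspace ?P a)" for x
    using that
    by (auto simp: sublevel_module_def carrier_homology pmap_homology_class subsetD[OF sublevel_mono(2)[OF that(1)]])
qed

end

theory Submission
  imports Defs
begin

text \<open>If \<open>e = \<parallel>f - g\<parallel>\<^sub>\<infinity>\<close> is finite and \<open>m \<ge> e\<close>, the inclusion of
  \<open>{f \<le> t - m}\<close> into \<open>{f \<le> t + m}\<close> factors through that of \<open>{g \<le> t - (m - e)}\<close> into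
  \<open>{g \<le> t + (m - e)}\<close>. Rank does not increase under factorisation, so lowering \<open>m\<close> by \<open>e\<close>
  passes from the landscape of \<open>f\<close> to that of \<open>g\<close>. The same argument for a shift of \<open>t\<close> shows
  that landscapes are 1-Lipschitz, hence measurable; this is needed because \<^const>\<open>esssup\<close> is
  \<open>\<infinity>\<close> on non-measurable functions.\<close>

section \<open>Dimensions of subspaces and images\<close>

text \<open>Independent subsets of \<open>U\<close> stay independent in \<open>V\<close>, so
  \<open>V.dim\<close> bounds their size and a maximal one is a finite basis of \<open>U\<close>.
  This also shows that \<open>U\<close> is finite-dimensional; otherwise \<open>vdim\<close> would
  give \<open>\<infinity>\<close>.\<close>

lemma vdim_subspace_le:
  assumes V: "vectorspace K V" and U: "submodule K U V"
  shows "vdim K (V\<lparr>carrier := U\<rparr>) \<le> vdim K V"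
proof (cases "vectorspace.fin_dim K V")
  case True
  interpret V: vectorspace K V by fact
  have subsp: "VectorSpace.subspace K U V"
    by (intro VectorSpace.subspace.intro V U)
  interpret U: vectorspace K "V\<lparr>carrier := U\<rparr>"
    using subsp by (rule V.subspace_is_vs)
  have UV: "U \<subseteq> carrier V" using U by (simp add: submodule_def)
  have li: "V.lin_indpt A" if "A \<subseteq> U" "U.lin_indpt A" for A
    using V.module.span_li_not_depend(2)[OF that(1) U] that(2) by simp
  have bound: "finite A \<and> card A \<le> V.dim" if "A \<subseteq> carrier (V\<lparr>carrier := U\<rparr>) \<and> U.lin_indpt A" for A
    using V.li_le_dim[OF True, of A] li[of A] that UV by auto
  have "{} \<subseteq> carrier (V\<lparr>carrier := U\<rparr>) \<and> U.lin_indpt {}"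
    by (simp add: U.lin_dep_def)
  with bound obtain A where fin: "finite A"
    and A: "maximal A (\<lambda>A. A \<subseteq> carrier (V\<lparr>carrier := U\<rparr>) \<and> U.lin_indpt A)"
    using maximal_exists[of "\<lambda>A. A \<subseteq> carrier (V\<lparr>carrier := U\<rparr>) \<and> U.lin_indpt A" V.dim "{}"]
    by blast
  from A have basis: "U.basis A" by (rule U.max_li_is_basis)
  have "U.fin_dim" "U.dim = card A"
    using fin basis U.dim_basis[OF fin basis] by (auto simp: U.fin_dim_def U.basis_def)
  moreover have "card A \<le> V.dim"
    using A bound by (simp add: maximal_def)
  ultimately show ?thesis by (simp add: vdim_def True)
qed (simp add: vdim_def)

text \<open>Rank-nullity if \<open>V\<close> is finite-dimensional; otherwise the bound is
  infinite.\<close>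

lemma vdim_surj_le:
  assumes "linear_map K V W T" "T ` carrier V = carrier W"
  shows "vdim K W \<le> vdim K V"
proof (cases "vectorspace.fin_dim K V")
  case True
  interpret linear_map K V W T by fact
  have "imT = carrier W" using assms(2) by (rule surj_imp_imT_carrier)
  then have "W.dim \<le> V.dim"
    using rank_nullity[OF True] W.carrier_vs_is_self by simp
  moreover have "W.fin_dim" using True assms(2) by (rule rank_nullity_main(2))
  ultimately show ?thesis by (simp add: vdim_def True)
qed (simp add: vdim_def)

lemma linear_mapI:
  assumes "vectorspace K V" "vectorspace K W"
    and "\<And>x. x \<in> carrier V \<Longrightarrow> T x \<in> carrier W"
    and "\<And>x y. \<lbrakk>x \<in> carrier V; y \<in> carrier V\<rbrakk> \<Longrightarrow> T (x \<oplus>\<^bsub>V\<^esub> y) = T x \<oplus>\<^bsub>W\<^esub> T y"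
    and "\<And>r x. \<lbrakk>r \<in> carrier K; x \<in> carrier V\<rbrakk> \<Longrightarrow> T (r \<odot>\<^bsub>V\<^esub> x) = r \<odot>\<^bsub>W\<^esub> T x"
  shows "linear_map K V W T"
proof (intro linear_map.intro mod_hom.intro mod_hom_axioms.intro assms(1,2))
  show "Module.module K V" "Module.module K W"
    using assms(1,2) by (simp_all add: vectorspace_def)
  show "T \<in> module_hom K V W"
    using assms(3-) by (simp add: module_hom_def Pi_def)
qed


lemma linear_map_restrict:
  assumes T: "linear_map K V W T" and U: "submodule K U V"
  shows "linear_map K (V\<lparr>carrier := U\<rparr>) W T"
proof -
  interpret linear_map K V W T by fact
  have UV: "x \<in> carrier V" if "x \<in> U" for x
    using U that by (auto simp: submodule_def)
  show ?thesis
    using V.subspace_is_vs[OF VectorSpace.subspace.intro[OF V.vectorspace_axioms U]] UV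
    by (intro linear_mapI) (simp_all add: W.vectorspace_axioms T_add T_smult)
qed

lemma linear_map_restrict_codomain:
  assumes T: "linear_map K V W T" and U: "submodule K U W" and "T ` carrier V \<subseteq> U"
  shows "linear_map K V (W\<lparr>carrier := U\<rparr>) T"
proof -
  interpret linear_map K V W T by fact
  show ?thesis
    using W.subspace_is_vs[OF VectorSpace.subspace.intro[OF W.vectorspace_axioms U]] assms(3)
    by (intro linear_mapI) (auto simp: V.vectorspace_axioms T_add T_smult)
qed

lemma linear_map_image_submodule:
  assumes T: "linear_map K V W T"
  shows "submodule K (T ` carrier V) W"
proof -
  interpret linear_map K V W T by fact
  show ?thesis using im_is_submodule by (simp add: im_def)
qed

text \<open>\<open>submodule\<close> also asserts that the ambient structure is a module, so passing
  from \<open>W\<close> to \<open>U'\<close> has to be justified.\<close>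

lemma submodule_within:
  assumes "submodule K U W" "submodule K U' W" "U \<subseteq> U'"
  shows "submodule K U (W\<lparr>carrier := U'\<rparr>)"
proof -
  have "Module.module K (W\<lparr>carrier := U'\<rparr>)"
    using assms(2) by (intro module.submodule_is_module) (simp_all add: submodule_def)
  then show ?thesis using assms by (simp add: submodule_def)
qed

text \<open>\<open>\<psi>\<close> maps the image of \<open>T\<close> after \<open>\<phi>\<close>
  onto the image of \<open>S\<close>, and the former is a subspace of the image of
  \<open>T\<close>.\<close>

lemma vdim_image_factor_le:
  assumes \<phi>: "linear_map K V W \<phi>" and T: "linear_map K W W' T" and \<psi>: "linear_map K W' V' \<psi>"
    and S: "\<And>x. x \<in> carrier V \<Longrightarrow> \<psi> (T (\<phi> x)) = S x"
  shows "vdim K (V'\<lparr>carrier := S ` carrier V\<rparr>) \<le> vdim K (W'\<lparr>carrier := T ` carrier W\<rparr>)"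
proof -
  interpret \<phi>: linear_map K V W \<phi> by fact
  interpret T: linear_map K W W' T by fact
  let ?U = "T ` \<phi> ` carrier V"
  have sub: "submodule K ?U W'"
    using linear_map_image_submodule[OF linear_map_restrict[OF T linear_map_image_submodule[OF \<phi>]]]
    by simp
  have im: "submodule K (T ` carrier W) W'"
    by (rule linear_map_image_submodule[OF T])
  have "?U \<subseteq> T ` carrier W" by auto
  then have sub': "submodule K ?U (W'\<lparr>carrier := T ` carrier W\<rparr>)"
    by (rule submodule_within[OF sub im])
  have \<psi>U: "linear_map K (W'\<lparr>carrier := ?U\<rparr>) V' \<psi>"
    by (rule linear_map_restrict[OF \<psi> sub])
  have eq: "\<psi> ` ?U = S ` carrier V"
    using S by (simp add: image_image)
  have "linear_map K (W'\<lparr>carrier := ?U\<rparr>) (V'\<lparr>carrier := S ` carrier V\<rparr>) \<psi>"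
    using linear_map_restrict_codomain[OF \<psi>U linear_map_image_submodule[OF \<psi>U]] eq by simp
  then have "vdim K (V'\<lparr>carrier := S ` carrier V\<rparr>) \<le> vdim K (W'\<lparr>carrier := ?U\<rparr>)"
    by (rule vdim_surj_le) (simp add: eq)
  also have "\<dots> \<le> vdim K (W'\<lparr>carrier := T ` carrier W\<rparr>)"
    using vdim_subspace_le[OF _ sub']
      T.W.subspace_is_vs[OF VectorSpace.subspace.intro[OF T.W.vectorspace_axioms im]] by simp
  finally show ?thesis .
qed

section \<open>Comparison of ranks in persistence modules\<close>

text \<open>The map from \<open>a\<close> to \<open>b\<close> factors through the one from
  \<open>a'\<close> to \<open>b'\<close>.\<close>

lemma (in persistence_module) pers_betti_mono:
  assumes "a \<le> a'" "a' \<le> b'" "b' \<le> b"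
  shows "pers_betti K P a b \<le> pers_betti K P a' b'"
  unfolding pers_betti_def
proof (rule vdim_image_factor_le)
  show "linear_map K (pspace P a) (pspace P a') (pmap P a a')"
    "linear_map K (pspace P a') (pspace P b') (pmap P a' b')"
    "linear_map K (pspace P b') (pspace P b) (pmap P b' b)"
    using assms by (intro linear_pmap; simp)+
  show "pmap P b' b (pmap P a' b' (pmap P a a' x)) = pmap P a b x" if "x \<in> carrier (pspace P a)" for x
    using pmap_trans[of a a' b' x] pmap_trans[of a b' b x] that assms by simp
qed

text \<open>The four sublevel sets form a single filtration, so the claim is monotonicity for the
  auxiliary function \<open>h\<close> having them as its sublevel sets at \<open>0, 1, 2, 3\<close>.\<close>

lemma pers_betti_sublevel_le:
  fixes X :: "'a topology" and f g :: "'a \<Rightarrow> real"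
  assumes "a' \<le> b'"
    and "\<And>x. \<lbrakk>x \<in> topspace X; f x \<le> a\<rbrakk> \<Longrightarrow> g x \<le> a'"
    and "\<And>x. \<lbrakk>x \<in> topspace X; g x \<le> b'\<rbrakk> \<Longrightarrow> f x \<le> b"
  shows "pers_betti class_ring
      (sublevel_module p X f :: ('k::field, ('k, 'a) field_chain set) pers_module) a b
    \<le> pers_betti class_ring
      (sublevel_module p X g :: ('k, ('k, 'a) field_chain set) pers_module) a' b'"
proof -
  define h :: "'a \<Rightarrow> real" where "h x = (if f x \<le> a then 0 else if g x \<le> a' then 1
    else if g x \<le> b' then 2 else if f x \<le> b then 3 else 4)" for x
  have *: "{x \<in> topspace X. h x \<le> 0} = {x \<in> topspace X. f x \<le> a}"
    "{x \<in> topspace X. h x \<le> 1} = {x \<in> topspace X. g x \<le> a'}"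
    "{x \<in> topspace X. h x \<le> 2} = {x \<in> topspace X. g x \<le> b'}"
    "{x \<in> topspace X. h x \<le> 3} = {x \<in> topspace X. f x \<le> b}"
    using assms by (force simp: h_def)+
  let ?H = "sublevel_module p X h :: ('k, ('k, 'a) field_chain set) pers_module"
  have "pers_betti class_ring ?H 0 3 \<le> pers_betti class_ring ?H 1 2"
    by (rule persistence_module.pers_betti_mono[OF persistence_module_sublevel]) simp_all
  then show ?thesis
    by (simp add: pers_betti_def sublevel_module_def sublevel_def *)
qed

section \<open>Shift inequalities for landscapes\<close>

text \<open>If \<open>m \<ge> e\<close> is admissible for \<open>P\<close> at \<open>t\<close>, then
  \<open>m - e\<close> is admissible for \<open>Q\<close> at \<open>s\<close>. Taking
  \<open>s = t\<close> compares two modules; taking \<open>P = Q\<close> compares two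
  points.\<close>

lemma landscape_le_add:
  assumes "0 \<le> e"
    and betti: "\<And>m. e \<le> m \<Longrightarrow>
      pers_betti K P (t - m) (t + m) \<le> pers_betti K Q (s - (m - e)) (s + (m - e))"
  shows "landscape K P k t \<le> landscape K Q k s + ereal e"
proof -
  let ?S = "{m. 0 \<le> m \<and> enat k \<le> pers_betti K P (t - m) (t + m)}"
  let ?S' = "{m. 0 \<le> m \<and> enat k \<le> pers_betti K Q (s - m) (s + m)}"
  \<comment> \<open>The value 0 for the empty supremum is essential here.\<close>
  have nonneg: "0 \<le> landscape K Q k s"
  proof (cases "?S' = {}")
    case False
    then obtain m where "m \<in> ?S'" by blast
    then have "0 \<le> ereal m" "ereal m \<le> landscape K Q k s"
      by (auto simp: landscape_def Let_def intro: SUP_upper)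
    then show ?thesis by (rule order_trans)
  qed (simp add: landscape_def)
  have bound: "ereal m \<le> landscape K Q k s + ereal e" if "m \<in> ?S" for m
  proof (cases "e \<le> m")
    case True
    then have "m - e \<in> ?S'" using that betti[of m] by (auto intro: order_trans)
    then have "ereal (m - e) \<le> landscape K Q k s"
      by (auto simp: landscape_def Let_def intro: SUP_upper)
    then have "ereal (m - e) + ereal e \<le> landscape K Q k s + ereal e"
      by (rule add_right_mono)
    then show ?thesis by simp
  next
    case False
    then have "ereal m \<le> 0 + ereal e" by simp
    also have "\<dots> \<le> landscape K Q k s + ereal e"
      using nonneg by (rule add_right_mono)
    finally show ?thesis .
  qed
  show ?thesis
  proof (cases "?S = {}")
    case True
    then show ?thesis using nonneg assms(1) by (simp add: landscape_def)
  next
    case False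
    then have "landscape K P k t = (SUP m\<in>?S. ereal m)"
      unfolding landscape_def Let_def by (rule if_not_P)
    then show ?thesis using bound by (auto intro: SUP_least)
  qed
qed

text \<open>With \<open>e = \<bar>t - s\<bar>\<close> and \<open>m \<ge> e\<close>, the interval of
  radius \<open>m - e\<close> about \<open>s\<close> lies in that of radius \<open>m\<close> about
  \<open>t\<close>.\<close>

lemma (in persistence_module) landscape_lipschitz:
  "landscape K P k t \<le> landscape K P k s + ereal \<bar>t - s\<bar>"
  by (intro landscape_le_add pers_betti_mono) auto

section \<open>Measurability and the essential supremum\<close>

text \<open>Lower semicontinuity is enough: all sets \<open>{t. a < L t}\<close> are open, also for
  infinite \<open>a\<close>.\<close>

lemma borel_measurable_ereal_lipschitz:
  fixes L :: "real \<Rightarrow> ereal"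
  assumes L: "\<And>s t. L t \<le> L s + ereal \<bar>t - s\<bar>"
  shows "L \<in> borel_measurable borel"
proof (rule borel_measurableI_greater)
  fix a
  have "open {t. a < L t}"
    unfolding open_dist
  proof (intro ballI)
    fix t assume "t \<in> {t. a < L t}"
    then have "a < L t" by simp
    show "\<exists>d>0. \<forall>s. dist s t < d \<longrightarrow> s \<in> {t. a < L t}"
    proof (cases a)
      case (real r)
      \<comment> \<open>\<open>L t\<close> may be infinite, so a real \<open>c\<close> below it
        provides the radius \<open>c - r\<close>.\<close>
      obtain c where c: "a < ereal c" "ereal c < L t"
        using ereal_dense2[OF \<open>a < L t\<close>] by blast
      have "a < L s" if "dist s t < c - r" for s
      proof (rule ccontr)
        assume "\<not> a < L s"
        then have "L t \<le> a + ereal \<bar>t - s\<bar>"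
          using L[of t s] add_right_mono[of "L s" a "ereal \<bar>t - s\<bar>"] by (simp add: not_less)
        with c(2) have "ereal c < a + ereal \<bar>t - s\<bar>" by (rule less_le_trans)
        then have "c < r + \<bar>t - s\<bar>" using real by simp
        then show False using that by (simp add: dist_real_def)
      qed
      then show ?thesis using c real by (intro exI[of _ "c - r"]) auto
    next
      case PInf
      then show ?thesis using \<open>a < L t\<close> by simp
    next
      case MInf
      \<comment> \<open>If \<open>L\<close> were \<open>-\<infinity>\<close> at \<open>s\<close>, it
        would be so at \<open>t\<close>; hence the set is the whole line and any radius
        works.\<close>
      then have "a < L s" for s using \<open>a < L t\<close> L[of t s] by (cases "L s") auto
      then show ?thesis by (auto intro: exI[of _ 1])
    qed
  qed
  then show "{t \<in> space borel. a < L t} \<in> sets borel" by simp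
qed

lemma borel_measurable_ext_abs_diff:
  assumes [measurable]: "u \<in> borel_measurable M" "v \<in> borel_measurable M"
  shows "(\<lambda>x. ext_abs_diff (u x) (v x)) \<in> borel_measurable M"
  unfolding ext_abs_diff_def by measurable

text \<open>As \<open>e\<close> is real, \<open>u\<close> and \<open>v\<close> are both finite or
  the same infinity; in the latter case their distance is 0 by convention.\<close>

lemma ext_abs_diff_le:
  assumes "u \<le> v + ereal e" "v \<le> u + ereal e"
  shows "ext_abs_diff u v \<le> ennreal e"
  using assms by (cases u; cases v) (auto simp: ext_abs_diff_def intro!: ennreal_leI)

lemma (in persistence_module) borel_measurable_landscape:
  "landscape K P k \<in> borel_measurable lebesgue"
  using landscape_lipschitz
  by (intro measurable_completion) (simp add: borel_measurable_ereal_lipschitz)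

lemma landscape_dist_infty_le:
  assumes "persistence_module K P" "persistence_module K Q"
    and "\<And>k t. landscape K P k t \<le> landscape K Q k t + ereal e"
    and "\<And>k t. landscape K Q k t \<le> landscape K P k t + ereal e"
  shows "landscape_dist_infty K P Q \<le> ennreal e"
  unfolding landscape_dist_infty_def
proof (rule esssup_I)
  show "(\<lambda>(k, t). ext_abs_diff (landscape K P k t) (landscape K Q k t))
      \<in> borel_measurable (count_space {1..} \<Otimes>\<^sub>M lebesgue)"
    \<comment> \<open>The first factor is countable, so measurability in \<open>t\<close> for each
      \<open>k\<close> suffices.\<close>
    by (intro measurable_pair_measure_countable1)
     (simp_all add: borel_measurable_ext_abs_diff
        persistence_module.borel_measurable_landscape[OF assms(1)]
        persistence_module.borel_measurable_landscape[OF assms(2)])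
  show "AE x in count_space {1..} \<Otimes>\<^sub>M lebesgue.
      (case x of (k, t) \<Rightarrow> ext_abs_diff (landscape K P k t) (landscape K Q k t)) \<le> ennreal e"
    using assms(3,4) by (intro AE_I2) (auto intro: ext_abs_diff_le)
qed

section \<open>Stability for sublevel sets\<close>

lemma landscape_sublevel_le:
  fixes X :: "'a topology" and f g :: "'a \<Rightarrow> real"
  assumes "0 \<le> e" "\<And>x. x \<in> topspace X \<Longrightarrow> \<bar>f x - g x\<bar> \<le> e"
  shows "landscape class_ring
      (sublevel_module p X f :: ('k::field, ('k, 'a) field_chain set) pers_module) k t
    \<le> landscape class_ring
      (sublevel_module p X g :: ('k, ('k, 'a) field_chain set) pers_module) k t + ereal e"
proof (rule landscape_le_add[OF assms(1)], rule pers_betti_sublevel_le)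
  fix m x
  assume "x \<in> topspace X"
  note assms(2)[OF this]
  then show "f x \<le> t - m \<Longrightarrow> g x \<le> t - (m - e)" "g x \<le> t + (m - e) \<Longrightarrow> f x \<le> t + m"
    by linarith+
qed simp

theorem theorem5p1:
  fixes X :: "'a topology" and f g :: "'a \<Rightarrow> real" and p :: nat
  shows "landscape_dist_infty (class_ring :: 'k::field ring)
           (sublevel_module p X f :: ('k, ('k, 'a) field_chain set) pers_module)
           (sublevel_module p X g :: ('k, ('k, 'a) field_chain set) pers_module)
         \<le> sup_dist X f g"
proof (cases "sup_dist X f g")
  case (real e)
  have "\<bar>f x - g x\<bar> \<le> e" if "x \<in> topspace X" for x
  proof -
    have "ennreal \<bar>f x - g x\<bar> \<le> sup_dist X f g"
      unfolding sup_dist_def using that by (rule SUP_upper)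
    then show ?thesis using real by simp
  qed
  then show ?thesis
    unfolding real(2) using real(1)
    \<comment> \<open>The second inequality is the first with \<open>f\<close> and \<open>g\<close>
      exchanged.\<close>
    by (intro landscape_dist_infty_le persistence_module_sublevel landscape_sublevel_le)
      (simp_all add: abs_minus_commute)
\<comment> \<open>An infinite distance makes the bound trivial.\<close>
qed simp

end
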